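(* Let $G$ be a locally compact abelian group and let $a,b,x\in G$. Then the matrix \[ Q_p := \begin{pmatrix} 1 & p(a) & p(x) \\ \overline{p(a)} & 1 & p(b)\\ \overline{p(x)} & \overline{p(b)} & 1 \end{pmatrix} \] belongs to $M_3(\mathbb{C})^+$ for every $p\in K(G)$ if and only if $x=ab$.
   Context: For a locally compact group $G$ with identity $e$, $K(G)$ (the state space of $G$) is the set of continuous positive definite functions $p:G\to\mathbb{C}$ with $p(e)=1$. Here $p$ is positive definite if $\sum_{j,k=1}^n \overline{c_j}c_k\,p(g_j^{-1}g_k)\ge 0$ for all $n\in\mathbb{N}$, $g_1,\dots,g_n\in G$, $c_1,\dots,c_n\in\mathbb{C}$. $M_3(\mathbb{C})^+$ denotes the set of positive (i.e. positive semidefinite Hermitian) $3\times 3$ complex matrices. *)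

theory Defs
  imports "HOL-Analysis.Analysis"
begin

text \<open>
  Topological groups in the library are written additively (without assuming commutativity),
  so \<open>- g + h\<close> stands for \<open>g\<^sup>-\<^sup>1 h\<close> and \<open>0\<close> for the identity \<open>e\<close>.
  Membership in \<open>\<real>\<^sub>\<ge>\<^sub>0 :: complex set\<close> means being real and nonnegative.
\<close>

definition positive_definite :: "('a::group_add \<Rightarrow> complex) \<Rightarrow> bool" where
  "positive_definite p \<longleftrightarrow>
     (\<forall>(n::nat) (g::nat \<Rightarrow> 'a) (c::nat \<Rightarrow> complex).
        (\<Sum>j=1..n. \<Sum>k=1..n. cnj (c j) * c k * p (- g j + g k)) \<in> \<real>\<^sub>\<ge>\<^sub>0)"

definition state_space :: "('a::topological_group_add \<Rightarrow> complex) set" where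
  "state_space = {p. continuous_on UNIV p \<and> positive_definite p \<and> p 0 = 1}"

definition positive_matrices :: "(complex^'n^'n) set" where
  "positive_matrices =
     {M. (\<forall>i j. M $ j $ i = cnj (M $ i $ j)) \<and>
         (\<forall>v::complex^'n. (\<Sum>i\<in>UNIV. cnj (v $ i) * (M *v v) $ i) \<in> \<real>\<^sub>\<ge>\<^sub>0)}"

definition Q_matrix :: "('a \<Rightarrow> complex) \<Rightarrow> 'a \<Rightarrow> 'a \<Rightarrow> 'a \<Rightarrow> complex^3^3" where
  "Q_matrix p a b x =
     vector [vector [1,         p a,       p x],
             vector [cnj (p a), 1,         p b],
             vector [cnj (p x), cnj (p b), 1  ]]"

end

theory Submission
  imports Defs
begin

text \<open>
  If \<open>x = a + b\<close>, the matrix is the Gram-type matrix \<open>p (- g\<^sub>i + g\<^sub>j)\<close> for \<open>g = (0, a, a + b)\<close>.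

  For the converse, a character \<open>\<chi>\<close> with \<open>\<chi> x \<noteq> \<chi> (a + b)\<close> would do, with the vector
  \<open>(\<chi> a, - 2, cnj (\<chi> b))\<close>. Characters are avoided as follows. Smearing a
  continuous positive definite \<open>p\<close> over multiples of \<open>h\<close> with Fejer weights twisted by a root of
  unity \<open>s\<close>, and averaging the quadratic form over \<open>s\<close> while rotating the vector by \<open>s\<close>, shows
  that nonnegativity of the form for \<open>(a, b, x)\<close> implies nonnegativity for \<open>(a - h, b, x - h)\<close>,
  up to a factor \<open>\<kappa> = 1 - 1/N\<close> at the two shifted entries. Doing this with \<open>h = a\<close> and then
  symmetrically (which negates the group elements) with \<open>b\<close> gives the form for \<open>(0, 0, a + b - x)\<close>, and a continuous positive
  definite function vanishing at \<open>a + b - x \<noteq> 0\<close> makes it negative.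

  Such a function is the autocorrelation of a bump function with respect to a translation-invariant
  positive functional. Commutativity gives the functional cheaply: average, with an invariant mean
  of the discrete group, the counting measures on the translates of a maximal separated set.
\<close>

section \<open>Invariant means on a discrete abelian group\<close>

text \<open>Encoded as a total functional constrained only at bounded functions, so that means are
  points of one product space and Tychonoff's theorem applies.\<close>

definition bounded_mean :: "(('a \<Rightarrow> real) \<Rightarrow> real) \<Rightarrow> bool" where
  "bounded_mean M \<longleftrightarrow>
     (\<forall>F G. bounded (range F) \<longrightarrow> bounded (range G) \<longrightarrow> M (\<lambda>x. F x + G x) = M F + M G) \<and>
     (\<forall>c F. bounded (range F) \<longrightarrow> M (\<lambda>x. c * F x) = c * M F) \<and>
     (\<forall>F. bounded (range F) \<longrightarrow> (\<forall>x. 0 \<le> F x) \<longrightarrow> 0 \<le> M F) \<and>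
     M (\<lambda>_. 1) = 1"

lemma bounded_meanD:
  assumes "bounded_mean M"
  shows bounded_mean_add: "bounded (range F) \<Longrightarrow> bounded (range G) \<Longrightarrow> M (\<lambda>x. F x + G x) = M F + M G"
    and bounded_mean_scale: "bounded (range F) \<Longrightarrow> M (\<lambda>x. c * F x) = c * M F"
    and bounded_mean_nonneg: "bounded (range F) \<Longrightarrow> (\<And>x. 0 \<le> F x) \<Longrightarrow> 0 \<le> M F"
    and bounded_mean_one: "M (\<lambda>_. 1) = 1"
  using assms unfolding bounded_mean_def by blast+

lemma bounded_range_iff_abs: "bounded (range F) \<longleftrightarrow> (\<exists>C::real. \<forall>x. \<bar>F x\<bar> \<le> C)"
  by (auto simp: bounded_iff)

lemma bounded_range_add:
  "bounded (range F) \<Longrightarrow> bounded (range G) \<Longrightarrow> bounded (range (\<lambda>x. F x + G x :: real))"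
  by (rule bounded_plus_comp)

lemma bounded_range_scale: "bounded (range F) \<Longrightarrow> bounded (range (\<lambda>x. c * F x :: real))"
  using bounded_scaling[of "range F" c] by (simp add: image_image)

lemma bounded_range_comp: "bounded (range F) \<Longrightarrow> bounded (range (\<lambda>x. F (h x)))"
  by (erule bounded_subset) auto

lemma bounded_range_sum:
  "(\<And>i. i \<in> I \<Longrightarrow> bounded (range (F i))) \<Longrightarrow> bounded (range (\<lambda>x. \<Sum>i\<in>I. F i x :: real))"
  by (induction I rule: infinite_finite_induct) (auto intro!: bounded_range_add)

lemma bounded_mean_mono:
  assumes M: "bounded_mean M" and F: "bounded (range F)" and G: "bounded (range G)"
    and le: "\<And>x. F x \<le> G x"
  shows "M F \<le> M G"
proof -
  have "0 \<le> M (\<lambda>x. G x + (- 1) * F x)"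
    using le by (intro bounded_mean_nonneg[OF M] bounded_range_add bounded_range_scale F G) auto
  then show ?thesis
    using bounded_mean_add[OF M G bounded_range_scale[OF F, of "- 1"]]
      bounded_mean_scale[OF M F, of "- 1"] by simp
qed

lemma bounded_mean_const: "bounded_mean M \<Longrightarrow> M (\<lambda>_. c) = c"
  using bounded_mean_scale[of M "\<lambda>_. 1" c] bounded_mean_one[of M] by simp

lemma bounded_mean_abs_le:
  assumes M: "bounded_mean M" and F: "\<And>x. \<bar>F x\<bar> \<le> C"
  shows "\<bar>M F\<bar> \<le> C"
proof -
  have bF: "bounded (range F)"
    using F bounded_range_iff_abs by blast
  have "M F \<le> C" "- C \<le> M F"
    using bounded_mean_mono[OF M bF, of "\<lambda>_. C"] bounded_mean_mono[OF M _ bF, of "\<lambda>_. - C"]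
      bounded_mean_const[OF M] F by (auto simp: abs_le_iff minus_le_iff)
  then show ?thesis by linarith
qed

text \<open>Precomposing with an average over finitely many translates keeps all the laws; this is
  how near invariance under one more element is built in.\<close>

lemma bounded_mean_average:
  assumes M: "bounded_mean M" and n: "n > 0"
  shows "bounded_mean (\<lambda>F. M (\<lambda>x. (\<Sum>k<n. F (x + h k)) / real n))"
  unfolding bounded_mean_def
proof (intro conjI allI impI)
  note br = bounded_range_scale[OF bounded_range_sum[OF bounded_range_comp]]
  fix F G :: "'a \<Rightarrow> real" and c :: real
  assume F: "bounded (range F)"
  show "M (\<lambda>x. (\<Sum>k<n. c * F (x + h k)) / real n) = c * M (\<lambda>x. (\<Sum>k<n. F (x + h k)) / real n)"
    using bounded_mean_scale[OF M br[OF F, where c="1 / real n"]] 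
    by (simp add: sum_distrib_left[symmetric])
  { assume G: "bounded (range G)"
    show "M (\<lambda>x. (\<Sum>k<n. F (x + h k) + G (x + h k)) / real n) =
       M (\<lambda>x. (\<Sum>k<n. F (x + h k)) / real n) + M (\<lambda>x. (\<Sum>k<n. G (x + h k)) / real n)"
      using bounded_mean_add[OF M br[OF F, where c="1 / real n"] br[OF G, where c="1 / real n"]]
      by (simp add: sum.distrib add_divide_distrib) }
  { assume "\<forall>x. 0 \<le> F x"
    then show "0 \<le> M (\<lambda>x. (\<Sum>k<n. F (x + h k)) / real n)"
      using bounded_mean_nonneg[OF M br[OF F, where c="1 / real n"]] by (simp add: sum_nonneg) }
next
  show "M (\<lambda>x. (\<Sum>k<n. 1) / real n) = 1"
    using n bounded_mean_one[OF M] by simp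
qed

text \<open>The bound is the telescoping error of an average over \<open>n + 1\<close> multiples of
  \<open>h\<close>. For fixed \<open>F\<close> and \<open>C\<close> it is a non-strict inequality
  between coordinates of \<open>M\<close>, hence a closed condition.\<close>

definition approx_invariant :: "'a::ab_group_add \<Rightarrow> nat \<Rightarrow> (('a \<Rightarrow> real) \<Rightarrow> real) \<Rightarrow> bool" where
  "approx_invariant h n M \<longleftrightarrow>
     (\<forall>F C. (\<forall>x. \<bar>F x\<bar> \<le> C) \<longrightarrow> \<bar>M (\<lambda>x. F (x + h)) - M F\<bar> \<le> 2 * C / real (Suc n))"

text \<open>Induction on \<open>T\<close>: averaging along the multiples of the new \<open>h\<close>
  makes the mean nearly invariant under \<open>h\<close>, and since translations commute, the near
  invariance already obtained survives.\<close>

lemma ex_approx_invariant_mean: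
  fixes T :: "('a::ab_group_add \<times> nat) set"
  assumes "finite T"
  shows "\<exists>M. bounded_mean M \<and> (\<forall>(h, n)\<in>T. approx_invariant h n M)"
  using assms
proof (induction T rule: finite_induct)
  case empty
  have "bounded_mean (\<lambda>F::'a \<Rightarrow> real. F 0)"
    by (auto simp: bounded_mean_def)
  then show ?case by blast
next
  case (insert t T)
  obtain h n where t: "t = (h, n)" by fastforce
  from insert obtain M where M: "bounded_mean M" and inv: "\<And>h n. (h, n) \<in> T \<Longrightarrow> approx_invariant h n M"
    by fast
  define u where "u k = (\<Sum>i<k. h)" for k :: nat \<comment> \<open>the multiple \<open>k h\<close>\<close>
  define A where "A F x = (\<Sum>k<Suc n. F (x + u k)) / real (Suc n)" for F :: "'a \<Rightarrow> real" and x
  have bm: "bounded_mean (\<lambda>F. M (A F))"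
    unfolding A_def by (intro bounded_mean_average M) simp
  have "approx_invariant h' n' (\<lambda>F. M (A F))" if "(h', n') \<in> T" for h' n'
    unfolding approx_invariant_def
  proof (intro allI impI)
    fix F :: "'a \<Rightarrow> real" and C :: real
    assume C: "\<forall>x. \<bar>F x\<bar> \<le> C"
    have "\<bar>A F x\<bar> \<le> C" for x
    proof -
      have "\<bar>\<Sum>k<Suc n. F (x + u k)\<bar> \<le> (\<Sum>k<Suc n. C)"
        by (rule order.trans[OF sum_abs sum_mono]) (use C in auto)
      then show ?thesis
        by (simp add: A_def divide_le_eq mult.commute del: sum.lessThan_Suc)
    qed
    moreover have "A (\<lambda>x. F (x + h')) = (\<lambda>x. A F (x + h'))"
      by (simp add: A_def fun_eq_iff ac_simps)
    ultimately show "\<bar>M (A (\<lambda>x. F (x + h'))) - M (A F)\<bar> \<le> 2 * C / real (Suc n')"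
      using inv[OF that] by (simp add: approx_invariant_def)
  qed
  moreover have "approx_invariant h n (\<lambda>F. M (A F))"
    unfolding approx_invariant_def
  proof (intro allI impI)
    fix F :: "'a \<Rightarrow> real" and C :: real
    assume C: "\<forall>x. \<bar>F x\<bar> \<le> C"
    have bF: "bounded (range F)"
      using C bounded_range_iff_abs by blast
    \<comment> \<open>The shifted and unshifted averages share all but their end terms;
      \<open>?D\<close> is what remains.\<close>
    let ?D = "\<lambda>x. (F (x + u (Suc n)) - F x) / real (Suc n)"
    have "A (\<lambda>x. F (x + h)) = (\<lambda>x. A F x + ?D x)"
    proof
      fix x
      have "(\<Sum>k<Suc n. F (x + u (Suc k)) - F (x + u k)) = F (x + u (Suc n)) - F (x + u 0)"
        by (rule sum_lessThan_telescope)
      then have "(\<Sum>k<Suc n. F (x + u (Suc k))) = (\<Sum>k<Suc n. F (x + u k)) + (F (x + u (Suc n)) - F x)"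
        by (simp add: sum_subtractf u_def del: sum.lessThan_Suc)
      moreover have "x + u (Suc k) = x + u k + h" for k
        by (simp add: u_def ac_simps)
      ultimately show "A (\<lambda>x. F (x + h)) x = A F x + ?D x"
        by (simp add: A_def add_divide_distrib[symmetric] ac_simps del: sum.lessThan_Suc)
    qed
    moreover have D: "\<bar>?D x\<bar> \<le> 2 * C / real (Suc n)" for x
    proof -
      have "\<bar>F (x + u (Suc n)) - F x\<bar> \<le> 2 * C"
        using C[rule_format, of "x + u (Suc n)"] C[rule_format, of x] by linarith
      then show ?thesis by (simp add: divide_right_mono)
    qed
    moreover have "bounded (range (A F))"
      using bounded_range_scale[OF bounded_range_sum[OF bounded_range_comp[OF bF]], of "1 / real (Suc n)" "\<lambda>k x. x + u k" "{..<Suc n}"]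
      by (simp add: A_def[abs_def] del: sum.lessThan_Suc)
    moreover have "bounded (range ?D)"
      using D bounded_range_iff_abs by blast
    ultimately have "M (A (\<lambda>x. F (x + h))) = M (A F) + M ?D"
      using bounded_mean_add[OF M] by metis
    then show "\<bar>M (A (\<lambda>x. F (x + h))) - M (A F)\<bar> \<le> 2 * C / real (Suc n)"
      using bounded_mean_abs_le[OF M D] by simp
  qed
  ultimately show ?case
    using bm t by (intro exI[of _ "\<lambda>F. M (A F)"]) auto
qed

text \<open>Each clause compares values of \<open>M\<close> at fixed functions, which are
  coordinates, and the premises do not mention \<open>M\<close>.\<close>

lemma closed_bounded_mean: "closed {M :: ('a \<Rightarrow> real) \<Rightarrow> real. bounded_mean M}"
  unfolding bounded_mean_def
  by (intro closed_Collect_conj closed_Collect_all closed_Collect_imp closed_Collect_eq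
      closed_Collect_le open_Collect_const continuous_intros continuous_on_product_coordinates)

lemma closed_approx_invariant: "closed {M. approx_invariant h n M}"
  unfolding approx_invariant_def
  by (intro closed_Collect_all closed_Collect_imp closed_Collect_le open_Collect_const
      continuous_intros continuous_on_product_coordinates)

text \<open>Finitely many of the closed near-invariance conditions can be met together, so by
  compactness all can; letting \<open>n\<close> tend to infinity gives exact invariance.\<close>

lemma ex_invariant_mean:
  "\<exists>M :: ('a::ab_group_add \<Rightarrow> real) \<Rightarrow> real.
     bounded_mean M \<and> (\<forall>F h. bounded (range F) \<longrightarrow> M (\<lambda>x. F (x + h)) = M F)"
proof -
  define b where "b F = (SUP x. \<bar>F x\<bar>)" for F :: "'a \<Rightarrow> real"
  have le_b: "\<bar>F x\<bar> \<le> b F" if "bounded (range F)" for F x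
  proof -
    from that obtain C where "\<And>y. \<bar>F y\<bar> \<le> C"
      using bounded_range_iff_abs by blast
    then show ?thesis
      unfolding b_def by (intro cSUP_upper bdd_aboveI[of _ C]) auto
  qed
  \<comment> \<open>The factor \<open>{0}\<close> at unbounded functions makes every factor of the
    product compact.\<close>
  define K where "K = (\<Pi>\<^sub>E F\<in>UNIV. if bounded (range F) then {- b F..b F} else {0})"
  have "compactin (product_topology (\<lambda>_. euclidean) UNIV) K"
    unfolding K_def by (subst compactin_PiE) auto
  then have K: "compact K"
    by (simp add: euclidean_product_topology)
  have "K \<inter> (\<Inter>t\<in>UNIV. {M. bounded_mean M} \<inter> {M. approx_invariant (fst t) (snd t) M}) \<noteq> {}"
  proof (rule compact_imp_fip_image[OF K])
    fix T :: "('a \<times> nat) set"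
    assume "finite T"
    from ex_approx_invariant_mean[OF this] obtain M where M: "bounded_mean M"
      and inv: "\<And>h n. (h, n) \<in> T \<Longrightarrow> approx_invariant h n M" by fast
    \<comment> \<open>Resetting \<open>M\<close> to 0 at unbounded functions puts it into
      \<open>K\<close> and preserves the laws, which constrain bounded functions only.\<close>
    define M' where "M' F = (if bounded (range F) then M F else 0)" for F
    have "bounded_mean M'"
      using M bounded_range_add bounded_range_scale unfolding bounded_mean_def M'_def by auto
    moreover have "approx_invariant h n M'" if "(h, n) \<in> T" for h n
      unfolding approx_invariant_def
    proof (intro allI impI)
      fix F :: "'a \<Rightarrow> real" and C :: real
      assume C: "\<forall>x. \<bar>F x\<bar> \<le> C"
      then have "bounded (range F)" using bounded_range_iff_abs by blast
      then show "\<bar>M' (\<lambda>x. F (x + h)) - M' F\<bar> \<le> 2 * C / real (Suc n)"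
        using C inv[OF that] bounded_range_comp[of F "\<lambda>x. x + h"]
        by (simp add: M'_def approx_invariant_def)
    qed
    moreover have "M' \<in> K"
      using bounded_mean_abs_le[OF M le_b] by (force simp: K_def M'_def abs_le_iff)
    ultimately show "K \<inter> (\<Inter>t\<in>T. {M. bounded_mean M} \<inter> {M. approx_invariant (fst t) (snd t) M}) \<noteq> {}"
      by fastforce
  qed (intro closed_Int closed_bounded_mean closed_approx_invariant)
  then obtain M :: "('a \<Rightarrow> real) \<Rightarrow> real" where M: "bounded_mean M" and inv: "\<And>h n. approx_invariant h n M"
    by fastforce
  have "M (\<lambda>x. F (x + h)) = M F" if "bounded (range F)" for F h
  proof -
    have "\<bar>M (\<lambda>x. F (x + h)) - M F\<bar> \<le> 2 * b F / real (Suc n)" for n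
      using inv le_b[OF that] unfolding approx_invariant_def by blast
    moreover have "(\<lambda>n. 2 * b F / real (Suc n)) \<longlonglongrightarrow> 0"
      by (rule real_tendsto_divide_at_top[OF tendsto_const filterlim_compose[OF filterlim_real_sequentially filterlim_Suc]])
    ultimately have "\<bar>M (\<lambda>x. F (x + h)) - M F\<bar> \<le> 0"
      by (intro LIMSEQ_le_const) auto
    then show ?thesis by simp
  qed
  with M show ?thesis by blast
qed

section \<open>An invariant functional on compactly supported functions\<close>

text \<open>The index set is cut down to nonzero terms because sums over infinite sets are 0.\<close>

definition orbit_sum :: "'a set \<Rightarrow> ('a \<Rightarrow> real) \<Rightarrow> 'a::ab_group_add \<Rightarrow> real" where
  "orbit_sum X F g = (\<Sum>y\<in>{y\<in>X. F (y + g) \<noteq> 0}. F (y + g))"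

definition bounded_compact_support :: "('a::topological_space \<Rightarrow> real) \<Rightarrow> bool" where
  "bounded_compact_support F \<longleftrightarrow>
     (\<exists>C. \<forall>y. \<bar>F y\<bar> \<le> C) \<and> (\<exists>K. compact K \<and> (\<forall>y. F y \<noteq> 0 \<longrightarrow> y \<in> K))"

definition separated_set :: "'a::ab_group_add set \<Rightarrow> 'a set \<Rightarrow> bool" where
  "separated_set U X \<longleftrightarrow> (\<forall>x\<in>X. \<forall>y\<in>X. x \<noteq> y \<longrightarrow> x - y \<notin> U)"

lemma open_vimage_add: "open U \<Longrightarrow> open {y. y + c \<in> U}"
  for c :: "'a::{topological_ab_group_add, t2_space}"
  using open_vimage[of U "\<lambda>y. y + c"] by (simp add: vimage_def continuous_intros)

lemma orbit_sum_eq: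
  assumes "finite Y" "Y \<subseteq> X" "\<And>y. y \<in> X \<Longrightarrow> F (y + g) \<noteq> 0 \<Longrightarrow> y \<in> Y"
  shows "orbit_sum X F g = (\<Sum>y\<in>Y. F (y + g))"
  unfolding orbit_sum_def using assms by (intro sum.mono_neutral_left) auto

text \<open>Zorn's lemma: a point violating the covering property could be added to
  \<open>X\<close>, where symmetry of \<open>U\<close> handles both orders of the
  difference.\<close>

lemma ex_maximal_separated_set:
  assumes "0 \<in> U" "\<And>u. u \<in> U \<Longrightarrow> - u \<in> U"
  obtains X where "separated_set U X" "\<And>g. \<exists>y\<in>X. g - y \<in> U"
proof -
  have "\<exists>X\<in>Collect (separated_set U). \<forall>Y\<in>Collect (separated_set U). X \<subseteq> Y \<longrightarrow> Y = X"
  proof (rule subset_Zorn_nonempty)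
    show "Collect (separated_set U) \<noteq> {}"
      by (auto simp: separated_set_def)
  next
    fix \<C> assume "\<C> \<noteq> {}" and chain: "subset.chain (Collect (separated_set U)) \<C>"
    have "x - y \<notin> U" if xy: "x \<in> A" "y \<in> B" "A \<in> \<C>" "B \<in> \<C>" "x \<noteq> y" for x y A B
    proof -
      have "A \<subseteq> B \<or> B \<subseteq> A"
        using chain xy by (simp add: subset_chain_def)
      then obtain C where "C \<in> \<C>" "x \<in> C" "y \<in> C" using xy by blast
      then show ?thesis
        using chain \<open>x \<noteq> y\<close> by (auto simp: subset_chain_def separated_set_def)
    qed
    then show "\<Union>\<C> \<in> Collect (separated_set U)"
      unfolding separated_set_def by blast
  qed
  then obtain X where X: "separated_set U X"
    and max: "\<And>Y. separated_set U Y \<Longrightarrow> X \<subseteq> Y \<Longrightarrow> Y = X" by blast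
  have "\<exists>y\<in>X. g - y \<in> U" for g
  proof (rule ccontr)
    assume *: "\<not> (\<exists>y\<in>X. g - y \<in> U)"
    have "y - g \<notin> U" if "y \<in> X" for y
      using * assms(2)[of "y - g"] that by auto
    then have "separated_set U (insert g X)"
      using * X by (auto simp: separated_set_def)
    then have "g \<in> X" using max[of "insert g X"] by blast
    then show False using * assms(1) by force
  qed
  with X that show ?thesis by blast
qed

text \<open>Pigeonhole: finitely many translates of a neighbourhood \<open>V\<close> with
  differences in \<open>U\<close> cover \<open>K\<close>, and each holds at most one point of any
  translate of \<open>X\<close>. The bound is uniform in \<open>g\<close>, which makes orbit sums
  bounded.\<close>

lemma separated_set_card_compact:
  fixes U :: "'a::{topological_ab_group_add, t2_space} set"
  assumes U: "open U" "0 \<in> U" and X: "separated_set U X" and K: "compact K"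
  obtains B where "\<And>g. finite {y\<in>X. y + g \<in> K}" "\<And>g. card {y\<in>X. y + g \<in> K} \<le> B"
proof -
  have "open ((\<lambda>z. fst z - snd z) -` U)"
    by (intro open_vimage U continuous_intros)
  then obtain V\<^sub>1 V\<^sub>2 where V12: "open V\<^sub>1" "open V\<^sub>2" "0 \<in> V\<^sub>1" "0 \<in> V\<^sub>2"
    "V\<^sub>1 \<times> V\<^sub>2 \<subseteq> (\<lambda>z. fst z - snd z) -` U"
    using U by (elim open_prod_elim[of _ "(0, 0)"]) auto
  define V where "V = V\<^sub>1 \<inter> V\<^sub>2"
  have V: "open V" "0 \<in> V"
    using V12 by (auto simp: V_def)
  have VU: "p - q \<in> U" if "p \<in> V" "q \<in> V" for p q
    using V12(5) that by (auto simp: V_def)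
  have op: "open {y. y + - c \<in> V}" for c
    by (rule open_vimage_add) (use V in simp)
  obtain C where C: "finite C" "K \<subseteq> (\<Union>c\<in>C. {y. y + - c \<in> V})"
  proof (rule compactE_image[OF K, of K "\<lambda>c. {y. y + - c \<in> V}"])
    show "K \<subseteq> (\<Union>c\<in>K. {y. y + - c \<in> V})"
      using V12 by (auto simp: V_def)
  qed (use op that in auto)
  have *: "finite {y\<in>X. y + g \<in> K} \<and> card {y\<in>X. y + g \<in> K} \<le> card C" for g
  proof -
    have "\<exists>c\<in>C. y + g - c \<in> V" if "y + g \<in> K" for y
      using C(2) that by force
    then obtain r where r: "\<And>y. y + g \<in> K \<Longrightarrow> r y \<in> C \<and> y + g - r y \<in> V"
      by metis
    have "inj_on r {y\<in>X. y + g \<in> K}"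
    proof (rule inj_onI, rule ccontr)
      fix y z assume yz: "y \<in> {y\<in>X. y + g \<in> K}" "z \<in> {y\<in>X. y + g \<in> K}" "r y = r z" "y \<noteq> z"
      then have "(y + g - r y) - (z + g - r z) \<in> U"
        by (intro VU conjunct2[OF r]) simp_all
      then show False using X yz by (auto simp: separated_set_def)
    qed
    moreover have "r ` {y\<in>X. y + g \<in> K} \<subseteq> C"
      using r by auto
    ultimately show ?thesis
      using C(1) by (simp add: card_inj_on_le inj_on_finite)
  qed
  show ?thesis
    by (rule that[of "card C"]) (use * in auto)
qed

lemma bounded_compact_supportE:
  assumes "bounded_compact_support F"
  obtains C K where "C \<ge> 0" "\<And>y. \<bar>F y\<bar> \<le> C" "compact K" "\<And>y. F y \<noteq> 0 \<Longrightarrow> y \<in> K"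
proof -
  from assms obtain C K where "\<And>y. \<bar>F y\<bar> \<le> C" "compact K" "\<And>y. F y \<noteq> 0 \<Longrightarrow> y \<in> K"
    unfolding bounded_compact_support_def by blast
  then show ?thesis
    using that[of "\<bar>C\<bar>" K] by (meson abs_ge_self abs_ge_zero order.trans)
qed

lemma bounded_compact_support_add:
  assumes "bounded_compact_support F" "bounded_compact_support G"
  shows "bounded_compact_support (\<lambda>y. F y + G y)"
proof -
  from assms(1) obtain C K where F: "\<And>y. \<bar>F y\<bar> \<le> C" "compact K" "\<And>y. F y \<noteq> 0 \<Longrightarrow> y \<in> K"
    unfolding bounded_compact_support_def by blast
  from assms(2) obtain C' K' where G: "\<And>y. \<bar>G y\<bar> \<le> C'" "compact K'" "\<And>y. G y \<noteq> 0 \<Longrightarrow> y \<in> K'"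
    unfolding bounded_compact_support_def by blast
  have "\<bar>F y + G y\<bar> \<le> C + C'" for y
    using F(1)[of y] G(1)[of y] by linarith
  moreover have "compact (K \<union> K')" using F(2) G(2) by blast
  moreover have "y \<in> K \<union> K'" if "F y + G y \<noteq> 0" for y
    using F(3)[of y] G(3)[of y] that by force
  ultimately show ?thesis
    unfolding bounded_compact_support_def by blast
qed

lemma bounded_compact_support_mult:
  assumes "bounded_compact_support F" "\<And>y. \<bar>G y\<bar> \<le> C"
  shows "bounded_compact_support (\<lambda>y. G y * F y)"
proof -
  from assms(1) obtain D K where F: "D \<ge> 0" "\<And>y. \<bar>F y\<bar> \<le> D" "compact K" "\<And>y. F y \<noteq> 0 \<Longrightarrow> y \<in> K"
    using bounded_compact_supportE by blast
  have "\<bar>G y * F y\<bar> \<le> C * D" for y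
    unfolding abs_mult using assms(2)[of y] F by (intro mult_mono) auto
  then show ?thesis
    unfolding bounded_compact_support_def using F(3,4) by (metis mult_zero_right)
qed

lemma bounded_compact_support_sum:
  "(\<And>i. i \<in> I \<Longrightarrow> bounded_compact_support (F i)) \<Longrightarrow> bounded_compact_support (\<lambda>y. \<Sum>i\<in>I. F i y)"
proof (induction I rule: infinite_finite_induct)
  case (insert i I)
  then show ?case by (simp add: bounded_compact_support_add)
qed (auto simp: bounded_compact_support_def intro!: exI[of _ "0::real"] exI[of _ "{}"])

lemma bounded_compact_support_translate:
  fixes F :: "'a::{topological_ab_group_add, t2_space} \<Rightarrow> real"
  assumes "bounded_compact_support F"
  shows "bounded_compact_support (\<lambda>y. F (y + h))"
proof -
  from assms obtain C K where F: "\<And>y. \<bar>F y\<bar> \<le> C" "compact K" "\<And>y. F y \<noteq> 0 \<Longrightarrow> y \<in> K"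
    unfolding bounded_compact_support_def by blast
  have "compact ((\<lambda>y. y - h) ` K)"
    by (intro compact_continuous_image F continuous_intros)
  moreover have "y \<in> (\<lambda>y. y - h) ` K" if "F (y + h) \<noteq> 0" for y
    using F(3)[OF that] by (auto intro: image_eqI[of _ _ "y + h"])
  ultimately show ?thesis
    unfolding bounded_compact_support_def using F(1) by blast
qed

text \<open>\<open>\<Lambda> F\<close> is the invariant mean of the orbit sum of \<open>F\<close>.
  The fourth property, from maximality of \<open>X\<close>, keeps it from vanishing; the fifth, from
  separation, later yields continuity of the autocorrelation.\<close>

lemma ex_invariant_functional:
  fixes U :: "'a::{topological_ab_group_add, t2_space} set"
  assumes U: "open U" "0 \<in> U" "\<And>u. u \<in> U \<Longrightarrow> - u \<in> U"
  obtains \<Lambda> :: "('a \<Rightarrow> real) \<Rightarrow> real" where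
    "\<And>F G. bounded_compact_support F \<Longrightarrow> bounded_compact_support G \<Longrightarrow>
       \<Lambda> (\<lambda>y. F y + G y) = \<Lambda> F + \<Lambda> G"
    "\<And>c F. bounded_compact_support F \<Longrightarrow> \<Lambda> (\<lambda>y. c * F y) = c * \<Lambda> F"
    "\<And>F h. bounded_compact_support F \<Longrightarrow> \<Lambda> (\<lambda>y. F (y + h)) = \<Lambda> F"
    "\<And>F \<delta>. bounded_compact_support F \<Longrightarrow> (\<And>y. F y \<ge> 0) \<Longrightarrow> (\<And>u. u \<in> U \<Longrightarrow> F u \<ge> \<delta>) \<Longrightarrow> \<Lambda> F \<ge> \<delta>"
    "\<And>K. compact K \<Longrightarrow> \<exists>B\<ge>0. \<forall>F C. (\<forall>y. \<bar>F y\<bar> \<le> C) \<longrightarrow> (\<forall>y. F y \<noteq> 0 \<longrightarrow> y \<in> K) \<longrightarrow> \<bar>\<Lambda> F\<bar> \<le> B * C"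
proof -
  obtain X where X: "separated_set U X" and max: "\<And>g. \<exists>y\<in>X. g - y \<in> U"
    using ex_maximal_separated_set[OF U(2,3)] by blast
  obtain M :: "('a \<Rightarrow> real) \<Rightarrow> real" where M: "bounded_mean M"
    and inv: "\<And>F h. bounded (range F) \<Longrightarrow> M (\<lambda>x. F (x + h)) = M F"
    using ex_invariant_mean by blast
  let ?S = "orbit_sum X"
  have fin: "finite {y\<in>X. y + g \<in> K}" if "compact K" for K g
    by (rule separated_set_card_compact[OF U(1,2) X that]) blast
  have S: "?S F g = (\<Sum>y\<in>{y\<in>X. y + g \<in> K}. F (y + g))"
    if "compact K" "\<And>y. F y \<noteq> 0 \<Longrightarrow> y \<in> K" for F K g
    using that by (intro orbit_sum_eq fin) auto
  have bd: "\<exists>B\<ge>0. \<forall>F C. (\<forall>y. \<bar>F y\<bar> \<le> C) \<longrightarrow> (\<forall>y. F y \<noteq> 0 \<longrightarrow> y \<in> K) \<longrightarrow> (\<forall>g. \<bar>?S F g\<bar> \<le> B * C)"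
    if K: "compact K" for K
  proof -
    obtain B where B: "\<And>g. card {y\<in>X. y + g \<in> K} \<le> B"
      by (rule separated_set_card_compact[OF U(1,2) X K]) blast
    have "\<bar>?S F g\<bar> \<le> real B * C" if F: "\<forall>y. \<bar>F y\<bar> \<le> C" "\<forall>y. F y \<noteq> 0 \<longrightarrow> y \<in> K" for F C g
    proof -
      have "C \<ge> 0" using F(1) abs_ge_zero order.trans by blast
      have "\<bar>?S F g\<bar> \<le> (\<Sum>y\<in>{y\<in>X. y + g \<in> K}. C)"
      proof -
        have "?S F g = (\<Sum>y\<in>{y\<in>X. y + g \<in> K}. F (y + g))"
          by (rule S[OF K]) (use F(2) in blast)
        also have "\<bar>\<dots>\<bar> \<le> (\<Sum>y\<in>{y\<in>X. y + g \<in> K}. C)"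
          using F(1) by (intro order.trans[OF sum_abs] sum_mono) blast
        finally show ?thesis .
      qed
      also have "\<dots> \<le> real B * C"
        using B[of g] \<open>C \<ge> 0\<close> by (simp add: mult_right_mono)
      finally show ?thesis .
    qed
    then show ?thesis by (intro exI[of _ "real B"]) auto
  qed
  have bS: "bounded (range (?S F))" if "bounded_compact_support F" for F
    using that bd unfolding bounded_compact_support_def bounded_range_iff_abs by metis
  show ?thesis
  proof (rule that[of "\<lambda>F. M (?S F)"])
    fix F :: "'a \<Rightarrow> real"
    assume F: "bounded_compact_support F"
    then obtain C K where K: "\<And>y. \<bar>F y\<bar> \<le> C" "compact K" "\<And>y. F y \<noteq> 0 \<Longrightarrow> y \<in> K"
      unfolding bounded_compact_support_def by blast
    have SF: "?S F g = (\<Sum>y\<in>{y\<in>X. y + g \<in> K}. F (y + g))" for g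
      by (rule S[OF K(2)]) (use K(3) in blast)
    {
      fix G :: "'a \<Rightarrow> real" assume G: "bounded_compact_support G"
      then obtain C' K' where K': "\<And>y. \<bar>G y\<bar> \<le> C'" "compact K'" "\<And>y. G y \<noteq> 0 \<Longrightarrow> y \<in> K'"
        unfolding bounded_compact_support_def by blast
      have "compact (K \<union> K')" using K K' by blast
      note S' = S[OF this]
      have "?S (\<lambda>y. F y + G y) g = ?S F g + ?S G g" for g
      proof -
        have "y \<in> K \<union> K'" if "F y + G y \<noteq> 0" for y
          using K(3)[of y] K'(3)[of y] that by force
        then show ?thesis
          using S'[of "\<lambda>y. F y + G y" g] S'[of F g] S'[of G g] K(3) K'(3) by (simp add: sum.distrib)
      qed
      then have "?S (\<lambda>y. F y + G y) = (\<lambda>g. ?S F g + ?S G g)" by blast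
      then show "M (?S (\<lambda>y. F y + G y)) = M (?S F) + M (?S G)"
        using bounded_mean_add[OF M bS[OF F] bS[OF G]] by simp
    }
    {
      fix c :: real
      have "?S (\<lambda>y. c * F y) = (\<lambda>g. c * ?S F g)"
      proof
        fix g
        have "?S (\<lambda>y. c * F y) g = (\<Sum>y\<in>{y\<in>X. y + g \<in> K}. c * F (y + g))"
          by (rule S[OF K(2)]) (use K(3) in auto)
        also have "\<dots> = c * ?S F g"
          by (simp only: sum_distrib_left SF)
        finally show "?S (\<lambda>y. c * F y) g = c * ?S F g" .
      qed
      then show "M (?S (\<lambda>y. c * F y)) = c * M (?S F)"
        using bounded_mean_scale[OF M bS[OF F]] by simp
    }
    {
      fix h
      \<comment> \<open>Translating \<open>F\<close> translates its orbit sum, and \<open>M\<close>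
        is invariant.\<close>
      have "?S (\<lambda>y. F (y + h)) = (\<lambda>g. ?S F (g + h))"
        by (rule ext) (simp only: orbit_sum_def add.assoc)
      then have "M (?S (\<lambda>y. F (y + h))) = M (\<lambda>g. ?S F (g + h))"
        by (rule arg_cong)
      also have "\<dots> = M (?S F)"
        by (rule inv[OF bS[OF F]])
      finally show "M (?S (\<lambda>y. F (y + h))) = M (?S F)" .
    }
    {
      fix \<delta> assume pos: "\<And>y. F y \<ge> 0" and \<delta>: "\<And>u. u \<in> U \<Longrightarrow> F u \<ge> \<delta>"
      have "\<delta> \<le> ?S F g" for g
      proof -
        \<comment> \<open>The covering property is applied to \<open>- g\<close>; symmetry of
          \<open>U\<close> turns \<open>- g - y\<close> into \<open>y + g\<close>.\<close>
        obtain y where y: "y \<in> X" "- g - y \<in> U" using max by blast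
        then have "y + g \<in> U" using U(3)[of "- g - y"] by (simp add: add.commute)
        show ?thesis
        proof (cases "y + g \<in> K")
          case True
          have "F (y + g) \<le> (\<Sum>y\<in>{y\<in>X. y + g \<in> K}. F (y + g))"
            by (rule member_le_sum[of y _ "\<lambda>y. F (y + g)"]) (use y True pos fin K(2) in auto)
          then show ?thesis
            using \<delta>[OF \<open>y + g \<in> U\<close>] SF[of g] by linarith
        next
          case False
          \<comment> \<open>Here \<open>\<delta>\<close> is at most \<open>F (y + g) = 0\<close>, so
            nonnegativity of the orbit sum suffices.\<close>
          then have "F (y + g) = 0" using K(3) by blast
          moreover have "0 \<le> ?S F g"
            unfolding orbit_sum_def by (intro sum_nonneg pos)
          ultimately show ?thesis
            using \<delta>[OF \<open>y + g \<in> U\<close>] by linarith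
        qed
      qed
      then show "\<delta> \<le> M (?S F)"
        using bounded_mean_mono[OF M _ bS[OF F], of "\<lambda>_. \<delta>"] bounded_mean_const[OF M, of \<delta>] by simp
    }
  next
    fix K :: "'a set" assume "compact K"
    from bd[OF this] obtain B where "B \<ge> 0" and B: "\<And>F C g. (\<forall>y. \<bar>F y\<bar> \<le> C) \<Longrightarrow>
        (\<forall>y. F y \<noteq> 0 \<longrightarrow> y \<in> K) \<Longrightarrow> \<bar>?S F g\<bar> \<le> B * C" by blast
    show "\<exists>B\<ge>0. \<forall>F C. (\<forall>y. \<bar>F y\<bar> \<le> C) \<longrightarrow> (\<forall>y. F y \<noteq> 0 \<longrightarrow> y \<in> K) \<longrightarrow> \<bar>M (?S F)\<bar> \<le> B * C"
    proof (intro exI[of _ B] conjI allI impI \<open>B \<ge> 0\<close>)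
      fix F :: "'a \<Rightarrow> real" and C :: real
      assume "\<forall>y. \<bar>F y\<bar> \<le> C" "\<forall>y. F y \<noteq> 0 \<longrightarrow> y \<in> K"
      then show "\<bar>M (?S F)\<bar> \<le> B * C"
        by (intro bounded_mean_abs_le[OF M] B)
    qed
  qed
qed

section \<open>Positive definite functions\<close>

text \<open>Transfer along a bijection to arbitrary finite index sets; pairs, booleans and the type
  \<open>3\<close> occur below.\<close>

lemma positive_definite_sum:
  assumes p: "positive_definite p" and I: "finite I"
  shows "(\<Sum>i\<in>I. \<Sum>j\<in>I. cnj (c i) * c j * p (- g i + g j)) \<in> \<real>\<^sub>\<ge>\<^sub>0"
proof -
  obtain h where h: "bij_betw h {1..card I} I"
    using ex_bij_betw_nat_finite_1[OF I] by blast
  have "(\<Sum>i=1..card I. \<Sum>j=1..card I. cnj (c (h i)) * c (h j) * p (- g (h i) + g (h j))) \<in> \<real>\<^sub>\<ge>\<^sub>0"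
    using p unfolding positive_definite_def by (elim allE[of _ "card I"] allE[of _ "\<lambda>i. g (h i)"] allE[of _ "\<lambda>i. c (h i)"])
  also have "(\<Sum>i=1..card I. \<Sum>j=1..card I. cnj (c (h i)) * c (h j) * p (- g (h i) + g (h j)))
      = (\<Sum>i=1..card I. \<Sum>j\<in>I. cnj (c (h i)) * c j * p (- g (h i) + g j))"
    by (intro sum.cong refl sum.reindex_bij_betw[OF h])
  also have "\<dots> = (\<Sum>i\<in>I. \<Sum>j\<in>I. cnj (c i) * c j * p (- g i + g j))"
    by (rule sum.reindex_bij_betw[OF h])
  finally show ?thesis .
qed

text \<open>The form of the smeared function with coefficients \<open>c j\<close> is the form of
  \<open>p\<close> at the points \<open>g j + u i\<close> with coefficients
  \<open>c j * d i\<close>.\<close>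

lemma positive_definite_smear:
  assumes p: "positive_definite p" and I: "finite I"
  shows "positive_definite (\<lambda>g. \<Sum>i\<in>I. \<Sum>j\<in>I. cnj (d i) * d j * p (- u i + g + u j))"
  unfolding positive_definite_def
proof (intro allI)
  fix n :: nat and g :: "nat \<Rightarrow> 'a" and c :: "nat \<Rightarrow> complex"
  let ?P = "{1..n} \<times> I"
  let ?t = "\<lambda>j i k l. cnj (c j * d i) * (c k * d l) * p (- (g j + u i) + (g k + u l))"
  have "(\<Sum>j=1..n. \<Sum>k=1..n. cnj (c j) * c k *
          (\<Sum>i\<in>I. \<Sum>l\<in>I. cnj (d i) * d l * p (- u i + (- g j + g k) + u l)))
      = (\<Sum>j=1..n. \<Sum>k=1..n. \<Sum>i\<in>I. \<Sum>l\<in>I. ?t j i k l)"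
    by (simp add: sum_distrib_left minus_add add.assoc mult_ac del: add_uminus_conv_diff)
  also have "\<dots> = (\<Sum>j=1..n. \<Sum>i\<in>I. \<Sum>k=1..n. \<Sum>l\<in>I. ?t j i k l)"
    by (intro sum.cong refl sum.swap)
  also have "\<dots> = (\<Sum>x\<in>?P. \<Sum>y\<in>?P. cnj (c (fst x) * d (snd x)) * (c (fst y) * d (snd y)) *
      p (- (g (fst x) + u (snd x)) + (g (fst y) + u (snd y))))"
    by (simp add: sum.cartesian_product')
  also have "\<dots> \<in> \<real>\<^sub>\<ge>\<^sub>0"
    using I by (intro positive_definite_sum[OF p, where c="\<lambda>x. c (fst x) * d (snd x)" 
        and g="\<lambda>x. g (fst x) + u (snd x)"]) auto
  finally show "(\<Sum>j=1..n. \<Sum>k=1..n. cnj (c j) * c k *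
          (\<Sum>i\<in>I. \<Sum>l\<in>I. cnj (d i) * d l * p (- u i + (- g j + g k) + u l))) \<in> \<real>\<^sub>\<ge>\<^sub>0" .
qed

lemma positive_definite_two:
  assumes "positive_definite p"
  shows "cnj z * z * p 0 + cnj z * w * p g + (cnj w * z * p (- g) + cnj w * w * p 0) \<in> \<real>\<^sub>\<ge>\<^sub>0"
  using positive_definite_sum[OF assms, of "UNIV :: bool set" "\<lambda>i. if i then w else z" "\<lambda>i. if i then g else 0"]
  by (simp add: UNIV_bool)

lemma positive_definite_zero: "positive_definite p \<Longrightarrow> p 0 \<in> \<real>\<^sub>\<ge>\<^sub>0"
  using positive_definite_two[of p 1 0 0] by simp

text \<open>The two-point forms with coefficients \<open>(1, 1)\<close> and \<open>(1, \<i>)\<close>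
  are real; their imaginary parts give the two components of the identity.\<close>

lemma positive_definite_minus:
  assumes "positive_definite p"
  shows "p (- g) = cnj (p g)"
proof -
  have "Im (p 0) = 0"
    using positive_definite_zero[OF assms] by (simp add: complex_nonneg_Reals_iff)
  then show ?thesis
    using positive_definite_two[OF assms, of 1 1 g] positive_definite_two[OF assms, of 1 \<i> g]
    by (simp add: complex_nonneg_Reals_iff complex_eq_iff)
qed

text \<open>With coefficients \<open>1\<close> and \<open>- cnj (p g)\<close> the diagonal terms
  vanish and the form is minus twice the squared modulus of \<open>p g\<close>.\<close>

lemma positive_definite_eq_zero:
  assumes p: "positive_definite p" and "p 0 = 0"
  shows "p g = 0"
proof -
  have "- 2 * ((Re (p g))\<^sup>2 + (Im (p g))\<^sup>2) \<ge> 0"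
    using positive_definite_two[OF p, of 1 "- cnj (p g)" g] \<open>p 0 = 0\<close> positive_definite_minus[OF p, of g]
    by (simp add: complex_nonneg_Reals_iff power2_eq_square algebra_simps)
  then have "(Re (p g))\<^sup>2 + (Im (p g))\<^sup>2 = 0"
    by (smt (verit) zero_le_power2)
  then show ?thesis by (simp add: complex_eq_iff)
qed

lemma positive_definite_scale:
  assumes "positive_definite p" "r \<in> \<real>\<^sub>\<ge>\<^sub>0"
  shows "positive_definite (\<lambda>g. r * p g)"
  unfolding positive_definite_def
proof (intro allI)
  fix n :: nat and g :: "nat \<Rightarrow> 'a" and c :: "nat \<Rightarrow> complex"
  have "r * (\<Sum>j=1..n. \<Sum>k=1..n. cnj (c j) * c k * p (- g j + g k)) \<in> \<real>\<^sub>\<ge>\<^sub>0"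
    using assms by (intro nonneg_Reals_mult_I) (auto simp: positive_definite_def)
  then show "(\<Sum>j=1..n. \<Sum>k=1..n. cnj (c j) * c k * (r * p (- g j + g k))) \<in> \<real>\<^sub>\<ge>\<^sub>0"
    by (simp add: sum_distrib_left mult_ac)
qed

section \<open>Fejer smearing along the multiples of one element\<close>

text \<open>A geometric sum whose ratio \<open>q\<close> satisfies \<open>q ^ Suc N = 1\<close>;
  exponents up to \<open>N\<close> give distinct powers of \<open>z\<close>, so \<open>q = 1\<close>
  only if \<open>i = j\<close>.\<close>

lemma sum_root_unity_orthogonal:
  fixes N :: nat
  defines "z \<equiv> cis (2 * pi / real (Suc N))"
  assumes "i \<le> N" "j \<le> N"
  shows "(\<Sum>r\<le>N. cnj ((z ^ r) ^ i) * (z ^ r) ^ j) = (if i = j then of_nat (Suc N) else 0)"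
proof -
  have z1: "cnj z * z = 1"
    by (simp add: z_def complex_norm_square[symmetric] mult.commute)
  define q where "q = cnj (z ^ i) * z ^ j"
  have pow: "cnj ((z ^ r) ^ i) * (z ^ r) ^ j = q ^ r" for r
    by (simp add: q_def power_mult_distrib power_mult[symmetric] mult.commute)
  have "z ^ Suc N = cis (real (Suc N) * (2 * pi / real (Suc N)))"
    unfolding z_def by (rule Complex.DeMoivre)
  also have "real (Suc N) * (2 * pi / real (Suc N)) = 2 * pi"
    by (simp del: of_nat_Suc)
  finally have zN: "z ^ Suc N = 1"
    by (simp only: cis_2pi)
  have "q ^ Suc N = cnj ((z ^ Suc N) ^ i) * (z ^ Suc N) ^ j"
    by (simp only: pow)
  then have qN: "q ^ Suc N = 1"
    by (simp only: zN) simp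
  have q1: "q = 1 \<longleftrightarrow> i = j"
  proof
    assume "i = j"
    then show "q = 1"
      using z1 by (simp add: q_def power_mult_distrib[symmetric])
  next
    assume "q = 1"
    have "z ^ j = (z * cnj z) ^ i * z ^ j"
      using z1 by (simp add: mult.commute)
    also have "\<dots> = z ^ i * q"
      by (simp add: q_def power_mult_distrib)
    finally have "z ^ i = z ^ j" using \<open>q = 1\<close> by simp
    moreover have "z ^ k = cis (2 * pi * real k / real (Suc N))" for k
      unfolding z_def Complex.DeMoivre by (simp add: mult_ac)
    ultimately show "i = j"
      using assms by (intro inj_onD[OF bij_betw_imp_inj_on[OF Complex.bij_betw_roots_unity[of "Suc N"]]]) auto
  qed
  have "(1 - q) * (\<Sum>r\<le>N. q ^ r) = 0"
    using qN sum_gp_basic[of q N] by simp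
  then have "i \<noteq> j \<Longrightarrow> (\<Sum>r\<le>N. q ^ r) = 0"
    using q1 by auto
  moreover have "i = j \<Longrightarrow> (\<Sum>r\<le>N. q ^ r) = of_nat (Suc N)"
    using q1 by simp
  ultimately show ?thesis
    unfolding pow by presburger
qed

text \<open>The constant sums \<open>\<Sum>i<m. h\<close> are the multiples \<open>m h\<close>.\<close>

definition fejer_smear :: "nat \<Rightarrow> 'a \<Rightarrow> complex \<Rightarrow> ('a \<Rightarrow> complex) \<Rightarrow> 'a::ab_group_add \<Rightarrow> complex" where
  "fejer_smear N h s p g =
     (\<Sum>m<N. \<Sum>m'<N. cnj (s ^ m) * s ^ m' * p (- (\<Sum>i<m. h) + g + (\<Sum>i<m'. h)))"

lemma positive_definite_fejer_smear:
  "positive_definite p \<Longrightarrow> positive_definite (fejer_smear N h s p)"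
  unfolding fejer_smear_def by (rule positive_definite_smear) auto

lemma continuous_on_fejer_smear:
  fixes p :: "'a::{topological_ab_group_add, t2_space} \<Rightarrow> complex"
  assumes "continuous_on UNIV p"
  shows "continuous_on UNIV (fejer_smear N h s p)"
  unfolding fejer_smear_def
  by (intro continuous_intros continuous_on_compose2[OF assms]) auto

text \<open>Orthogonality keeps the terms with \<open>m = m'\<close>, or \<open>m = m' + 1\<close>
  in the twisted sum: \<open>N\<close> copies of \<open>p g\<close> against \<open>N - 1\<close>
  copies of \<open>p (g - h)\<close>. This ratio is the loss factor of the shift.\<close>

lemma
  fixes N :: nat and p :: "'a::ab_group_add \<Rightarrow> complex"
  defines "z \<equiv> cis (2 * pi / real (Suc N))"
  shows sum_fejer_smear:
      "(\<Sum>r\<le>N. fejer_smear N h (z ^ r) p g) = of_nat (Suc N) * of_nat N * p g"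
    and sum_twisted_fejer_smear:
      "(\<Sum>r\<le>N. z ^ r * fejer_smear N h (z ^ r) p g) = of_nat (Suc N) * of_nat (N - 1) * p (g - h)"
proof -
  let ?a = "\<lambda>m m'. p (- (\<Sum>i<m. h) + g + (\<Sum>i<m'. h))"
  \<comment> \<open>\<open>e\<close> is 0 for the plain sum and 1 for the twisted one. The roots
    have order \<open>N + 1\<close> because the exponent \<open>m' + e\<close> can reach
    \<open>N\<close> and must not be identified with 0.\<close>
  have gen: "(\<Sum>r\<le>N. \<Sum>m<N. \<Sum>m'<N. cnj ((z ^ r) ^ m) * (z ^ r) ^ (m' + e) * ?a m m')
      = of_nat (Suc N) * (\<Sum>m'<N. if m' + e < N then ?a (m' + e) m' else 0)" if "e \<le> 1" for e
  proof -
    have "(\<Sum>r\<le>N. \<Sum>m<N. \<Sum>m'<N. cnj ((z ^ r) ^ m) * (z ^ r) ^ (m' + e) * ?a m m')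
        = (\<Sum>m'<N. \<Sum>m<N. \<Sum>r\<le>N. cnj ((z ^ r) ^ m) * (z ^ r) ^ (m' + e) * ?a m m')"
      by (subst sum.swap, subst (2) sum.swap, subst sum.swap) (rule refl)
    also have "\<dots> = (\<Sum>m'<N. \<Sum>m<N. (if m = m' + e then of_nat (Suc N) else 0) * ?a m m')"
      unfolding z_def sum_distrib_right[symmetric] using that
      by (intro sum.cong refl arg_cong2[where f="(*)"] sum_root_unity_orthogonal) auto
    also have "\<dots> = (\<Sum>m'<N. \<Sum>m<N. if m = m' + e then of_nat (Suc N) * ?a m m' else 0)"
      by (intro sum.cong) auto
    also have "\<dots> = (\<Sum>m'<N. if m' + e < N then of_nat (Suc N) * ?a (m' + e) m' else 0)"
      by (simp add: sum.delta)
    also have "\<dots> = of_nat (Suc N) * (\<Sum>m'<N. if m' + e < N then ?a (m' + e) m' else 0)"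
      unfolding sum_distrib_left by (intro sum.cong) auto
    finally show ?thesis .
  qed
  show "(\<Sum>r\<le>N. fejer_smear N h (z ^ r) p g) = of_nat (Suc N) * of_nat N * p g"
    using gen[of 0] by (simp add: fejer_smear_def mult.assoc)
  have "(\<Sum>m'<N. if m' + 1 < N then ?a (m' + 1) m' else 0) = (\<Sum>m'<N. if m' < N - 1 then p (g - h) else 0)"
    by (intro sum.cong refl) (auto simp: algebra_simps)
  also have "\<dots> = of_nat (N - 1) * p (g - h)"
  proof -
    have "{m'. m' < N \<and> m' < N - 1} = {..<N - 1}" by auto
    then show ?thesis by (simp add: sum.If_cases Int_def)
  qed
  finally show "(\<Sum>r\<le>N. z ^ r * fejer_smear N h (z ^ r) p g) = of_nat (Suc N) * of_nat (N - 1) * p (g - h)"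
    using gen[of 1] by (simp add: fejer_smear_def sum_distrib_left mult_ac)
qed

section \<open>The three-by-three form and its transformations\<close>

text \<open>The form of the Hermitian matrix with diagonal \<open>p 0\<close> and entries
  \<open>k * p \<alpha>\<close>, \<open>l * p \<beta>\<close>, \<open>m * p \<xi>\<close> at
  positions (1,2), (2,3), (1,3). \<open>p 0\<close> is not normalised, since smearing changes
  it.\<close>

definition nonneg_form :: "real \<Rightarrow> 'a \<Rightarrow> real \<Rightarrow> 'a \<Rightarrow> real \<Rightarrow> 'a::topological_group_add \<Rightarrow> bool" where
  "nonneg_form k \<alpha> l \<beta> m \<xi> \<longleftrightarrow>
     (\<forall>p v\<^sub>1 v\<^sub>2 v\<^sub>3. continuous_on UNIV p \<longrightarrow> positive_definite p \<longrightarrow>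
       0 \<le> ((cmod v\<^sub>1)\<^sup>2 + (cmod v\<^sub>2)\<^sup>2 + (cmod v\<^sub>3)\<^sup>2) * Re (p 0) +
           2 * Re (k * (cnj v\<^sub>1 * v\<^sub>2 * p \<alpha>) + l * (cnj v\<^sub>2 * v\<^sub>3 * p \<beta>) + m * (cnj v\<^sub>1 * v\<^sub>3 * p \<xi>)))"

text \<open>Reverse the coordinates of the vector and conjugate. This brings the second group
  element into first place, where the shift acts.\<close>

lemma nonneg_form_swap:
  assumes "nonneg_form k \<alpha> l \<beta> m \<xi>"
  shows "nonneg_form l (- \<beta>) k (- \<alpha>) m (- \<xi>)"
  unfolding nonneg_form_def
proof (intro allI impI)
  fix p :: "'a \<Rightarrow> complex" and v\<^sub>1 v\<^sub>2 v\<^sub>3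
  assume p: "continuous_on UNIV p" "positive_definite p"
  show "0 \<le> ((cmod v\<^sub>1)\<^sup>2 + (cmod v\<^sub>2)\<^sup>2 + (cmod v\<^sub>3)\<^sup>2) * Re (p 0) +
      2 * Re (l * (cnj v\<^sub>1 * v\<^sub>2 * p (- \<beta>)) + k * (cnj v\<^sub>2 * v\<^sub>3 * p (- \<alpha>)) + m * (cnj v\<^sub>1 * v\<^sub>3 * p (- \<xi>)))"
    using assms[unfolded nonneg_form_def, rule_format, OF p, of v\<^sub>3 v\<^sub>2 v\<^sub>1]
    by (simp add: positive_definite_minus[OF p(2)] algebra_simps)
qed

text \<open>Each smeared function is tested with the first coordinate multiplied by
  \<open>cnj (z ^ r)\<close>. Only the entries (1,2) and (1,3) acquire the factor
  \<open>z ^ r\<close>, so summing over \<open>r\<close> shifts them by \<open>h\<close> and leaves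
  the others in place.\<close>

lemma nonneg_form_shift:
  fixes \<alpha> :: "'a::{topological_ab_group_add, t2_space}"
  assumes form: "nonneg_form k \<alpha> l \<beta> m \<xi>" and "N > 0"
  defines "\<kappa> \<equiv> real (N - 1) / real N"
  shows "nonneg_form (\<kappa> * k) (\<alpha> - h) l \<beta> (\<kappa> * m) (\<xi> - h)"
  unfolding nonneg_form_def
proof (intro allI impI)
  fix p :: "'a \<Rightarrow> complex" and v\<^sub>1 v\<^sub>2 v\<^sub>3
  assume p: "continuous_on UNIV p" "positive_definite p"
  define z where "z = cis (2 * pi / real (Suc N))"
  define q where "q r = fejer_smear N h (z ^ r) p" for r
  let ?n = "(cmod v\<^sub>1)\<^sup>2 + (cmod v\<^sub>2)\<^sup>2 + (cmod v\<^sub>3)\<^sup>2"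
  let ?L = "real (Suc N)"
  have norm: "cmod (cnj (z ^ r) * v\<^sub>1) = cmod v\<^sub>1" for r
    by (simp add: z_def norm_mult norm_power)
  have twist: "cnj (cnj s * v\<^sub>1) * w * t = cnj v\<^sub>1 * w * (s * t)" for s w t
    by simp
  have "0 \<le> ?n * Re (q r 0) + 2 * Re (k * (cnj v\<^sub>1 * v\<^sub>2 * (z ^ r * q r \<alpha>))
      + l * (cnj v\<^sub>2 * v\<^sub>3 * q r \<beta>) + m * (cnj v\<^sub>1 * v\<^sub>3 * (z ^ r * q r \<xi>)))" for r
    using form[unfolded nonneg_form_def, rule_format, of "q r" "cnj (z ^ r) * v\<^sub>1" v\<^sub>2 v\<^sub>3]
      positive_definite_fejer_smear[OF p(2)] continuous_on_fejer_smear[OF p(1)]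
    unfolding norm twist q_def by blast
  then have "0 \<le> (\<Sum>r\<le>N. ?n * Re (q r 0) + 2 * Re (k * (cnj v\<^sub>1 * v\<^sub>2 * (z ^ r * q r \<alpha>))
      + l * (cnj v\<^sub>2 * v\<^sub>3 * q r \<beta>) + m * (cnj v\<^sub>1 * v\<^sub>3 * (z ^ r * q r \<xi>))))"
    by (intro sum_nonneg)
  also have "\<dots> = ?n * Re (\<Sum>r\<le>N. q r 0) + 2 * Re (k * (cnj v\<^sub>1 * v\<^sub>2 * (\<Sum>r\<le>N. z ^ r * q r \<alpha>))
      + l * (cnj v\<^sub>2 * v\<^sub>3 * (\<Sum>r\<le>N. q r \<beta>)) + m * (cnj v\<^sub>1 * v\<^sub>3 * (\<Sum>r\<le>N. z ^ r * q r \<xi>)))"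
    by (simp only: sum.distrib sum_distrib_left[symmetric] Re_sum[symmetric])
  also have "\<dots> = ?n * Re (of_real (?L * real N) * p 0) +
      2 * Re (k * (cnj v\<^sub>1 * v\<^sub>2 * (of_real (?L * real (N - 1)) * p (\<alpha> - h)))
      + l * (cnj v\<^sub>2 * v\<^sub>3 * (of_real (?L * real N) * p \<beta>))
      + m * (cnj v\<^sub>1 * v\<^sub>3 * (of_real (?L * real (N - 1)) * p (\<xi> - h))))"
    unfolding q_def z_def sum_fejer_smear sum_twisted_fejer_smear by simp
  \<comment> \<open>This exposes \<open>(N + 1) * N\<close> as a common positive factor, cancelled
    at the end.\<close>
  also have "real (N - 1) = \<kappa> * real N"
    using \<open>N > 0\<close> by (simp add: \<kappa>_def)
  also have "?n * Re (of_real (?L * real N) * p 0) +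
      2 * Re (k * (cnj v\<^sub>1 * v\<^sub>2 * (of_real (?L * (\<kappa> * real N)) * p (\<alpha> - h)))
      + l * (cnj v\<^sub>2 * v\<^sub>3 * (of_real (?L * real N) * p \<beta>))
      + m * (cnj v\<^sub>1 * v\<^sub>3 * (of_real (?L * (\<kappa> * real N)) * p (\<xi> - h)))) =
      ?L * real N * (?n * Re (p 0) + 2 * Re ((\<kappa> * k) * (cnj v\<^sub>1 * v\<^sub>2 * p (\<alpha> - h))
      + l * (cnj v\<^sub>2 * v\<^sub>3 * p \<beta>) + (\<kappa> * m) * (cnj v\<^sub>1 * v\<^sub>3 * p (\<xi> - h))))"
    by (simp add: algebra_simps)
  finally show "0 \<le> ?n * Re (p 0) + 2 * Re (of_real (\<kappa> * k) * (cnj v\<^sub>1 * v\<^sub>2 * p (\<alpha> - h))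
      + l * (cnj v\<^sub>2 * v\<^sub>3 * p \<beta>) + of_real (\<kappa> * m) * (cnj v\<^sub>1 * v\<^sub>3 * p (\<xi> - h)))"
    using \<open>N > 0\<close> by (intro mult_left_le_imp_le[of "?L * real N" 0]) simp_all
qed

section \<open>Passing between the matrix and the form\<close>

text \<open>Entries below the diagonal contribute the conjugates of those above, hence twice a real
  part.\<close>

lemma mult_Q_matrix:
  "(\<Sum>i\<in>UNIV. cnj (v $ i) * (Q_matrix p a b x *v v) $ i) =
     of_real ((cmod (v $ 1))\<^sup>2 + (cmod (v $ 2))\<^sup>2 + (cmod (v $ 3))\<^sup>2) +
     of_real (2 * Re (cnj (v $ 1) * v $ 2 * p a + cnj (v $ 2) * v $ 3 * p b + cnj (v $ 1) * v $ 3 * p x))"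
  by (simp add: matrix_vector_mult_def Q_matrix_def sum_3 complex_eq_iff cmod_power2)
    (simp add: power2_eq_square algebra_simps)

text \<open>Dividing \<open>p\<close> by \<open>p 0\<close> gives a state; if
  \<open>p 0 = 0\<close>, then \<open>p\<close> and with it the form vanish.\<close>

lemma nonneg_form_of_Q_matrix:
  assumes Q: "\<And>p. p \<in> state_space \<Longrightarrow> Q_matrix p a b x \<in> positive_matrices"
  shows "nonneg_form 1 a 1 b 1 x"
  unfolding nonneg_form_def
proof (intro allI impI)
  fix p :: "'a \<Rightarrow> complex" and v\<^sub>1 v\<^sub>2 v\<^sub>3
  assume p: "continuous_on UNIV p" "positive_definite p"
  let ?n = "(cmod v\<^sub>1)\<^sup>2 + (cmod v\<^sub>2)\<^sup>2 + (cmod v\<^sub>3)\<^sup>2"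
  obtain r where r: "p 0 = of_real r" "r \<ge> 0"
    using positive_definite_zero[OF p(2)] by (auto elim: nonneg_Reals_cases)
  show "0 \<le> ?n * Re (p 0) + 2 * Re (complex_of_real 1 * (cnj v\<^sub>1 * v\<^sub>2 * p a) +
      complex_of_real 1 * (cnj v\<^sub>2 * v\<^sub>3 * p b) + complex_of_real 1 * (cnj v\<^sub>1 * v\<^sub>3 * p x))"
  proof (cases "r = 0")
    case True
    then show ?thesis
      using positive_definite_eq_zero[OF p(2)] r by simp
  next
    case False
    define q where "q g = of_real (1 / r) * p g" for g
    have "q 0 = 1"
      using r False by (simp add: q_def)
    moreover have "continuous_on UNIV q" "positive_definite q"
      unfolding q_def using p r by (intro continuous_intros positive_definite_scale; simp)+
    ultimately have "q \<in> state_space"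
      by (simp add: state_space_def)
    from Q[OF this] have "(\<Sum>i\<in>UNIV. cnj (vector [v\<^sub>1, v\<^sub>2, v\<^sub>3] $ i) *
        (Q_matrix q a b x *v vector [v\<^sub>1, v\<^sub>2, v\<^sub>3]) $ i) \<in> \<real>\<^sub>\<ge>\<^sub>0"
      unfolding positive_matrices_def by blast
    then have "0 \<le> r * (?n + 2 * Re (cnj v\<^sub>1 * v\<^sub>2 * q a + cnj v\<^sub>2 * v\<^sub>3 * q b + cnj v\<^sub>1 * v\<^sub>3 * q x))"
      unfolding mult_Q_matrix of_real_add[symmetric] nonneg_Reals_of_real_iff using r by simp
    also have "\<dots> = ?n * Re (p 0) + 2 * Re (of_real r * (cnj v\<^sub>1 * v\<^sub>2 * q a + cnj v\<^sub>2 * v\<^sub>3 * q b + cnj v\<^sub>1 * v\<^sub>3 * q x))"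
      using r by (simp only: Re_complex_of_real times_complex.simps Im_complex_of_real) (simp add: algebra_simps)
    also have "of_real r * (cnj v\<^sub>1 * v\<^sub>2 * q a + cnj v\<^sub>2 * v\<^sub>3 * q b + cnj v\<^sub>1 * v\<^sub>3 * q x)
       = cnj v\<^sub>1 * v\<^sub>2 * p a + cnj v\<^sub>2 * v\<^sub>3 * p b + cnj v\<^sub>1 * v\<^sub>3 * p x"
      using False by (simp add: q_def field_simps)
    finally show ?thesis by simp
  qed
qed

text \<open>For the points \<open>0\<close>, \<open>a\<close>, \<open>a + b\<close>, the entry (2,3)
  is at \<open>- a + (a + b) = b\<close>; the entries below the diagonal follow by
  conjugation.\<close>

lemma Q_matrix_sum_positive:
  assumes "p \<in> state_space"
  shows "Q_matrix p a b (a + b) \<in> positive_matrices"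
proof -
  have p: "positive_definite p" "p 0 = 1"
    using assms by (auto simp: state_space_def)
  define g where "g = (\<lambda>i::3. if i = 1 then 0 else if i = 2 then a else a + b)"
  have Q: "Q_matrix p a b (a + b) $ i $ j = p (- g i + g j)" for i j
  proof -
    have "p (- a) = cnj (p a)" "p (- b) = cnj (p b)" "p (- b + - a) = cnj (p (a + b))" 
      using positive_definite_minus[OF p(1)] by (simp_all flip: minus_add del: add_uminus_conv_diff)
    moreover have "- b + - a + (a + b) = 0"
      by (simp flip: minus_add del: add_uminus_conv_diff)
    moreover have "p (- b + - a + a) = p (- b)" by (simp add: add.assoc)
    moreover have "p (- a + (a + b)) = p b" by (simp flip: add.assoc)
    ultimately show ?thesis
      using exhaust_3[of i] exhaust_3[of j] p(2)
      by (auto simp: Q_matrix_def g_def minus_add)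
  qed
  have "cnj (p (- g i + g j)) = p (- g j + g i)" for i j
    using positive_definite_minus[OF p(1), of "- g i + g j"] by (simp add: minus_add)
  then show ?thesis
    using positive_definite_sum[OF p(1), of UNIV _ g]
    by (simp add: positive_matrices_def Q matrix_vector_mult_def sum_distrib_left mult_ac)
qed

section \<open>Separating points by positive definite functions\<close>

text \<open>Locally compact Hausdorff spaces are completely regular. The bump is one minus a
  function separating \<open>z\<close> from the complement of a neighbourhood \<open>u\<close>
  contained in a compact \<open>K\<close>.\<close>

lemma ex_bump_function:
  fixes z :: "'a::t2_space"
  assumes lc: "locally compact (UNIV :: 'a set)" and W: "open W" "z \<in> W"
  obtains f :: "'a \<Rightarrow> real" and K where "continuous_on UNIV f" "\<And>y. 0 \<le> f y" "\<And>y. f y \<le> 1" "f z = 1"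
    "compact K" "K \<subseteq> W" "\<And>y. f y \<noteq> 0 \<Longrightarrow> y \<in> K"
proof -
  have nb: "\<exists>u v. open u \<and> compact v \<and> z \<in> u \<and> u \<subseteq> v \<and> v \<subseteq> W" if "open W" "z \<in> W" for W :: "'a set" and z
    using lc[unfolded locally_def, rule_format, of W z] that by auto
  from nb[OF W] obtain u K where u: "open u" "compact K" "z \<in> u" "u \<subseteq> K" "K \<subseteq> W"
    by blast
  have "locally_compact_space (euclidean :: 'a topology)"
    unfolding locally_compact_space_def using nb[OF open_UNIV] by simp
  moreover have "Hausdorff_space (euclidean :: 'a topology)"
    unfolding Hausdorff_space_def disjnt_def using hausdorff by auto
  ultimately have "completely_regular_space (euclidean :: 'a topology)"
    using locally_compact_regular_imp_completely_regular_space by blast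
  then obtain f :: "'a \<Rightarrow> real" where f: "continuous_map euclidean (top_of_set {0..1}) f" "f z = 0" "f ` (- u) \<subseteq> {1}"
    unfolding completely_regular_space_def
    using u by (elim allE[of _ "- u"] allE[of _ z]) auto
  have range: "f y \<in> {0..1}" and cont: "continuous_on UNIV f" for y
    using f(1) by (auto simp: continuous_map_in_subtopology)
  show ?thesis
  proof (rule that[of "\<lambda>y. 1 - f y" K])
    show "continuous_on UNIV (\<lambda>y. 1 - f y)"
      by (intro continuous_intros cont)
    show "y \<in> K" if "1 - f y \<noteq> 0" for y
      using that f(3) u(4) by force
  qed (use range f(2) u in auto)
qed

text \<open>The real part of the form splits into the real forms of \<open>Re c\<close> and
  \<open>Im c\<close>; the imaginary part cancels because \<open>w\<close> is even.\<close>

lemma positive_definite_of_real: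
  fixes w :: "'a::group_add \<Rightarrow> real"
  assumes sym: "\<And>g. w (- g) = w g"
    and nonneg: "\<And>(n::nat) g a. 0 \<le> (\<Sum>j=1..n. \<Sum>k=1..n. a j * a k * w (- g j + g k))"
  shows "positive_definite (\<lambda>g. complex_of_real (w g))"
  unfolding positive_definite_def complex_nonneg_Reals_iff
proof (intro allI conjI)
  fix n :: nat and g :: "nat \<Rightarrow> 'a" and c :: "nat \<Rightarrow> complex"
  let ?S = "\<Sum>j=1..n. \<Sum>k=1..n. cnj (c j) * c k * complex_of_real (w (- g j + g k))"
  have "Re ?S = (\<Sum>j=1..n. \<Sum>k=1..n. Re (c j) * Re (c k) * w (- g j + g k)) +
      (\<Sum>j=1..n. \<Sum>k=1..n. Im (c j) * Im (c k) * w (- g j + g k))"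
    unfolding sum.distrib[symmetric] Re_sum by (intro sum.cong refl) (simp add: algebra_simps)
  then show "0 \<le> Re ?S"
    using nonneg by simp
  have "Im ?S = (\<Sum>j=1..n. \<Sum>k=1..n. Re (c j) * Im (c k) * w (- g j + g k)) -
      (\<Sum>j=1..n. \<Sum>k=1..n. Im (c j) * Re (c k) * w (- g j + g k))"
    unfolding sum_subtractf[symmetric] Im_sum by (intro sum.cong refl) (simp add: algebra_simps)
  also have "w (- g j + g k) = w (- g k + g j)" for j k
    using sym[of "- g j + g k"] by (simp add: minus_add)
  then have "(\<Sum>j=1..n. \<Sum>k=1..n. Im (c j) * Re (c k) * w (- g j + g k)) =
      (\<Sum>k=1..n. \<Sum>j=1..n. Re (c k) * Im (c j) * w (- g k + g j))"
    by (subst sum.swap) (simp add: mult.commute)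
  finally show "Im ?S = 0" by simp
qed

text \<open>For a bump \<open>f\<close> at 0, the form of its autocorrelation \<open>v\<close> is
  \<open>\<Lambda>\<close> of a square. If \<open>f\<close> is supported where \<open>y\<close> and
  \<open>y + d\<close> never both lie, then \<open>v d = 0\<close>.\<close>

lemma ex_continuous_positive_definite_vanishing_at:
  fixes d :: "'a::{topological_ab_group_add, t2_space}"
  assumes lc: "locally compact (UNIV :: 'a set)" and "d \<noteq> 0"
  obtains p :: "'a \<Rightarrow> complex" where "continuous_on UNIV p" "positive_definite p" "p 0 = 1" "p d = 0"
proof -
  obtain A B where AB: "open A" "open B" "0 \<in> A" "d \<in> B" "A \<inter> B = {}"
    using hausdorff[of 0 d] \<open>d \<noteq> 0\<close> by metis
  \<comment> \<open>If \<open>y\<close> and \<open>y + d\<close> were both in \<open>W\<close>, then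
    \<open>y + d\<close> would lie in both \<open>A\<close> and \<open>B\<close>.\<close>
  define W where "W = A \<inter> {y. y + d \<in> B}"
  have W: "open W" "0 \<in> W"
    unfolding W_def using AB open_vimage_add[of B d] by auto
  obtain f :: "'a \<Rightarrow> real" and K where f: "continuous_on UNIV f" "\<And>y. 0 \<le> f y" "\<And>y. f y \<le> 1" "f 0 = 1"
    and K: "compact K" "K \<subseteq> W" "\<And>y. f y \<noteq> 0 \<Longrightarrow> y \<in> K"
    using ex_bump_function[OF lc W] by blast
  have abs_f: "\<bar>f y\<bar> \<le> 1" for y
    using f(2,3)[of y] by simp
  have bf: "bounded_compact_support f"
    unfolding bounded_compact_support_def using abs_f K by blast
  \<comment> \<open>A symmetric neighbourhood of 0 on which the square of \<open>f\<close> exceeds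
    1/4, which bounds \<open>v 0\<close> from below.\<close>
  define U where "U = {u. 1 / 2 < f u \<and> 1 / 2 < f (- u)}"
  have "open U"
    unfolding U_def
    by (intro open_Collect_conj open_Collect_less continuous_intros f continuous_on_compose2[OF f(1)]) auto
  then obtain \<Lambda> :: "('a \<Rightarrow> real) \<Rightarrow> real" where
    add: "\<And>F G. bounded_compact_support F \<Longrightarrow> bounded_compact_support G \<Longrightarrow> \<Lambda> (\<lambda>y. F y + G y) = \<Lambda> F + \<Lambda> G"
    and scale: "\<And>c F. bounded_compact_support F \<Longrightarrow> \<Lambda> (\<lambda>y. c * F y) = c * \<Lambda> F"
    and inv: "\<And>F h. bounded_compact_support F \<Longrightarrow> \<Lambda> (\<lambda>y. F (y + h)) = \<Lambda> F"
    and pos: "\<And>F \<delta>. bounded_compact_support F \<Longrightarrow> (\<And>y. F y \<ge> 0) \<Longrightarrow> (\<And>u. u \<in> U \<Longrightarrow> F u \<ge> \<delta>) \<Longrightarrow> \<Lambda> F \<ge> \<delta>"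
    and bd: "\<And>K. compact K \<Longrightarrow> \<exists>B\<ge>0. \<forall>F C. (\<forall>y. \<bar>F y\<bar> \<le> C) \<longrightarrow> (\<forall>y. F y \<noteq> 0 \<longrightarrow> y \<in> K) \<longrightarrow> \<bar>\<Lambda> F\<bar> \<le> B * C"
  proof (rule ex_invariant_functional[of U])
    show "0 \<in> U" using f(4) by (simp add: U_def)
  qed (auto simp: U_def)
  have bcs_mult: "bounded_compact_support (\<lambda>y. f y * f (y + x))" for x
    by (intro bounded_compact_support_mult[where C=1] bounded_compact_support_translate bf abs_f)
  have \<Lambda>_sum: "\<Lambda> (\<lambda>y. \<Sum>i\<in>I. F i y) = (\<Sum>i\<in>I. \<Lambda> (F i))"
    if "finite I" "\<And>i. bounded_compact_support (F i)" for I :: "nat set" and F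
    using that(1)
  proof (induction I rule: finite_induct)
    case empty
    then show ?case using scale[OF bf, of 0] by simp
  next
    case (insert i I)
    then show ?case
      using add[OF that(2) bounded_compact_support_sum[of I F, OF that(2)]] by simp
  qed
  define v where "v x = \<Lambda> (\<lambda>y. f y * f (y + x))" for x
  have v_diff: "v (- g + h) = \<Lambda> (\<lambda>y. f (y + g) * f (y + h))" for g h
    using inv[OF bcs_mult[of "- g + h"], of g] by (simp add: v_def algebra_simps)
  have v0: "v 0 \<ge> 1 / 4"
  proof -
    have *: "1 / 4 \<le> f u * f (u + 0)" if "u \<in> U" for u
      using mult_mono[of "1 / 2" "f u" "1 / 2" "f u"] that by (simp add: U_def)
    show ?thesis
      unfolding v_def by (intro pos bcs_mult * mult_nonneg_nonneg f(2))
  qed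
  have v_minus: "v (- g) = v g" for g
    using v_diff[of g 0] by (simp add: v_def mult.commute)
  have v_nonneg: "0 \<le> (\<Sum>j=1..n. \<Sum>k=1..n. a j * a k * v (- g j + g k))" for n :: nat and g a
  proof -
    have b1: "bounded_compact_support (\<lambda>y. a j * a k * (f (y + g j) * f (y + g k)))" for j k
      by (intro bounded_compact_support_mult[where C="\<bar>a j * a k\<bar>"]
        bounded_compact_support_mult[where C=1] bounded_compact_support_translate bf abs_f) simp
    have b2: "bounded_compact_support (\<lambda>y. \<Sum>k=1..n. a j * a k * (f (y + g j) * f (y + g k)))" for j
      by (intro bounded_compact_support_sum b1)
    have b3: "bounded_compact_support (\<lambda>y. f (y + g j) * f (y + g k))" for j k
      by (intro bounded_compact_support_mult[where C=1] bounded_compact_support_translate bf abs_f)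
    have "(\<Sum>j=1..n. \<Sum>k=1..n. a j * a k * v (- g j + g k)) =
        \<Lambda> (\<lambda>y. \<Sum>j=1..n. \<Sum>k=1..n. a j * a k * (f (y + g j) * f (y + g k)))"
      by (simp only: \<Lambda>_sum[OF finite_atLeastAtMost b2] \<Lambda>_sum[OF finite_atLeastAtMost b1] scale[OF b3] v_diff)
    also have "(\<lambda>y. \<Sum>j=1..n. \<Sum>k=1..n. a j * a k * (f (y + g j) * f (y + g k))) =
        (\<lambda>y. (\<Sum>j=1..n. a j * f (y + g j))\<^sup>2)"
      by (simp add: power2_eq_square sum_product mult_ac)
    also have "0 \<le> \<Lambda> \<dots>"
    proof -
      have "bounded_compact_support (\<lambda>y. \<Sum>j=1..n. \<Sum>k=1..n. a j * a k * (f (y + g j) * f (y + g k)))"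
        by (intro bounded_compact_support_sum b1)
      then have "bounded_compact_support (\<lambda>y. (\<Sum>j=1..n. a j * f (y + g j))\<^sup>2)"
        by (simp add: power2_eq_square sum_product mult_ac)
      then show ?thesis by (intro pos) auto
    qed
    finally show ?thesis .
  qed
  have vd: "v d = 0"
  proof -
    have "f y * f (y + d) = 0" for y
    proof (rule ccontr)
      assume "f y * f (y + d) \<noteq> 0"
      then have "y \<in> W" "y + d \<in> W" using K by auto
      then show False using AB by (auto simp: W_def)
    qed
    then have "v d = \<Lambda> (\<lambda>y. 0)"
      unfolding v_def by presburger
    then show ?thesis
      using scale[OF bf, of 0] by simp
  qed
  have "continuous_on UNIV v"
    unfolding continuous_on_def
  proof (intro ballI tendstoI)
    fix x\<^sub>0 and e :: real assume "e > 0"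
    obtain B where "B \<ge> 0" and B: "\<And>F C. (\<forall>y. \<bar>F y\<bar> \<le> C) \<Longrightarrow> (\<forall>y. F y \<noteq> 0 \<longrightarrow> y \<in> K) \<Longrightarrow> \<bar>\<Lambda> F\<bar> \<le> B * C"
      using bd[OF K(1)] by blast
    \<comment> \<open>The \<open>+ 1\<close> covers \<open>B = 0\<close> and makes
      \<open>B * \<epsilon> < e\<close> strict.\<close>
    define \<epsilon> where "\<epsilon> = e / (B + 1)"
    have "\<epsilon> > 0" using \<open>e > 0\<close> \<open>B \<ge> 0\<close> by (simp add: \<epsilon>_def)
    \<comment> \<open>By a tube argument over the compact \<open>K\<close>, \<open>f (y + x)\<close>
      is close to its value at \<open>x = x\<^sub>0\<close> uniformly in \<open>y \<in> K\<close>;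
      the factor \<open>f y\<close> vanishes elsewhere.\<close>
    have "continuous_on (UNIV \<times> K) (\<lambda>z. f (snd z + fst z))"
      by (intro continuous_on_compose2[OF f(1)] continuous_intros) auto
    then obtain X\<^sub>0 where X0: "x\<^sub>0 \<in> X\<^sub>0" "open X\<^sub>0"
      and close: "\<forall>x\<in>X\<^sub>0 \<inter> UNIV. \<forall>y\<in>K. dist (f (snd (x, y) + fst (x, y))) (f (snd (x\<^sub>0, y) + fst (x\<^sub>0, y))) \<le> \<epsilon>"
      by (rule continuous_on_prod_compactE[OF _ K(1) UNIV_I \<open>\<epsilon> > 0\<close>])
    have "dist (v x) (v x\<^sub>0) < e" if "x \<in> X\<^sub>0" for x
    proof -
      have "bounded_compact_support (\<lambda>y. - 1 * (f y * f (y + x\<^sub>0)))"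
        by (intro bounded_compact_support_mult[where C=1] bcs_mult) simp
      from add[OF bcs_mult[of x] this] scale[OF bcs_mult[of x\<^sub>0], of "- 1"]
      have "v x - v x\<^sub>0 = \<Lambda> (\<lambda>y. f y * (f (y + x) - f (y + x\<^sub>0)))"
        by (simp add: v_def algebra_simps)
      also have "\<bar>\<dots>\<bar> \<le> B * \<epsilon>"
      proof (intro B allI impI)
        fix y
        show "\<bar>f y * (f (y + x) - f (y + x\<^sub>0))\<bar> \<le> \<epsilon>"
        proof (cases "y \<in> K")
          case True
          then have "\<bar>f (y + x) - f (y + x\<^sub>0)\<bar> \<le> \<epsilon>"
            using close that by (auto simp: dist_real_def)
          then show ?thesis
            using mult_mono[OF abs_f[of y], of "\<bar>f (y + x) - f (y + x\<^sub>0)\<bar>" \<epsilon>] by (simp add: abs_mult)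
        next
          case False
          then have "f y = 0" using K(3) by blast
          then show ?thesis using \<open>\<epsilon> > 0\<close> by simp
        qed
      next
        fix y assume "f y * (f (y + x) - f (y + x\<^sub>0)) \<noteq> 0"
        then show "y \<in> K" using K(3) by auto
      qed
      also have "B * \<epsilon> < e"
        using \<open>e > 0\<close> \<open>B \<ge> 0\<close> by (simp add: \<epsilon>_def field_simps)
      finally show ?thesis by (simp add: dist_real_def)
    qed
    then show "\<forall>\<^sub>F x in at x\<^sub>0 within UNIV. dist (v x) (v x\<^sub>0) < e"
      unfolding eventually_at_topological using X0 by blast
  qed
  moreover have "0 \<le> (\<Sum>j=1..n. \<Sum>k=1..n. a j * a k * (v (- g j + g k) / v 0))" for n :: nat and g a
    using divide_nonneg_nonneg[OF v_nonneg[where n=n and a=a and g=g], of "v 0"] v0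
    by (simp add: sum_divide_distrib)
  then have "positive_definite (\<lambda>g. complex_of_real (v g / v 0))"
    using v_minus by (intro positive_definite_of_real) simp_all
  ultimately show ?thesis
    using v0 vd by (intro that[of "\<lambda>g. complex_of_real (v g / v 0)"]) (auto intro!: continuous_intros)
qed

theorem theorem3p2:
  fixes a b x :: "'a::{topological_ab_group_add, t2_space}"
  assumes "locally compact (UNIV :: 'a set)"
  shows "(\<forall>p\<in>state_space. Q_matrix p a b x \<in> positive_matrices) \<longleftrightarrow> x = a + b"
proof
  assume Q: "\<forall>p\<in>state_space. Q_matrix p a b x \<in> positive_matrices"
  show "x = a + b"
  proof (rule ccontr)
    assume "x \<noteq> a + b"
    \<comment> \<open>This is the third group element left by the two shifts below.\<close>
    then have "a - x + b \<noteq> 0"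
      by (metis add.commute add_diff_eq diff_add_eq eq_iff_diff_eq_0)
    then obtain p where p: "continuous_on UNIV p" "positive_definite p" "p 0 = 1" "p (a - x + b) = 0"
      using ex_continuous_positive_definite_vanishing_at[OF assms] by blast
    have "nonneg_form 1 a 1 b 1 x"
      using Q by (intro nonneg_form_of_Q_matrix) blast
    \<comment> \<open>Shifting by \<open>a\<close> turns the first group element into 0 at the cost
      of a factor 3/4; the swap then puts \<open>- b\<close> first, ready for the shift by
      \<open>- b\<close>.\<close>
    from nonneg_form_swap[OF nonneg_form_shift[OF this, of 4 a]]
    have "nonneg_form 1 (- b) (3 / 4) 0 (3 / 4) (a - x)" by simp
    from nonneg_form_shift[OF this, of 4 "- b"]
    have "nonneg_form (3 / 4) 0 (3 / 4) 0 (9 / 16) (a - x + b)" by simp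
    \<comment> \<open>\<open>17/4 - 2 * 9/4 < 0\<close>; \<open>N = 4\<close> is the least \<open>N\<close> making \<open>2 + c\<^sup>2 - 4 c \<kappa>\<close> negative at its minimum \<open>c = 2 \<kappa>\<close>\<close>
    from this[unfolded nonneg_form_def, rule_format, OF p(1,2), of 1 "- (3 / 2)" 1]
    show False
      by (simp add: p(3,4) power2_eq_square)
  qed
next
  assume "x = a + b"
  then show "\<forall>p\<in>state_space. Q_matrix p a b x \<in> positive_matrices"
    by (simp add: Q_matrix_sum_positive)
qed

end
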